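(* Let $\mathcal{X}$ be a totally ordered domain and let $\alpha>0$ be the accuracy parameter. For every $n\in\mathbb{N}$ and $\delta,\beta\le 1/(10000n^2)$, any $(\beta,1/8,\delta)$-perfectly generalizing and $(\alpha,1/32)$-accurate proper agnostic learner for threshold functions over $\mathcal{X}$ requires sample complexity $n=\Omega\left(\log^*|\mathcal{X}|/\alpha\right)$.
   Context: Threshold functions over $\mathcal{X}$ are $h_x(y)=1$ if $y\le x$ and $0$ otherwise, for $x\in\mathcal{X}$. A proper $(\alpha,\gamma)$-accurate agnostic learner takes $n$ labelled examples drawn i.i.d. from an arbitrary distribution $\mathcal{D}_L$ over $\mathcal{X}\times\{0,1\}$ and outputs a threshold $h$ with $\Pr[err(h)\le\min_f err(f)+\alpha]\ge1-\gamma$, where $err(h)=\Pr_{(x,y)\sim\mathcal{D}_L}[h(x)\ne y]$ and the minimum is over threshold functions. Distributions $\mathcal{J}_1,\mathcal{J}_2$ over $\mathcal{R}$ are $(\varepsilon,\delta)$-close if for every $\mathcal{O}\subseteq\mathcal{R}$ each assigns probability at most $e^{\varepsilon}$ times the other's plus $\delta$. A mechanism $\mathcal{M}\colon\mathcal{Y}^n\to\mathcal{R}$ is $(\beta,\varepsilon,\delta)$-perfectly generalizing if for every distribution $\mathcal{C}$ over $\mathcal{Y}$ there is a distribution $\mathrm{Sim}_{\mathcal{C}}$ over $\mathcal{R}$ such that with probability at least $1-\beta$ over $T\sim_{i.i.d.}\mathcal{C}^n$, $\mathcal{M}(T)$ and $\mathrm{Sim}_{\mathcal{C}}$ are $(\varepsilon,\delta)$-close.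 $\log^*$ is the iterated logarithm.
   Formalization: The domain is taken finite and the accuracy parameter is restricted to 0 < α < 1/2; for α ≥ 1 a constant learner with n = 1, and for 1/2 < α < 1 a smoothed majority vote between the extreme thresholds, refutes the bound with a universal constant. *)

theory Defs
  imports "HOL-Probability.Probability"
begin

text \<open>
  All domains in the main statement are finite, so a distribution over a set \<open>S\<close> is
  a \<open>pmf\<close> whose support is contained in \<open>S\<close>.  A sample of size \<open>n\<close> is a list of length \<open>n\<close>,
  and the i.i.d. product distribution is \<^const>\<open>replicate_pmf\<close>.
\<close>

definition log_star :: "real \<Rightarrow> nat" where
  "log_star x = (LEAST k. (log 2 ^^ k) x \<le> 1)"

definition dist_on :: "'y set \<Rightarrow> 'y pmf set" where
  "dist_on S = {p. set_pmf p \<subseteq> S}"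

definition mechanism :: "'y set \<Rightarrow> nat \<Rightarrow> 'r set \<Rightarrow> ('y list \<Rightarrow> 'r pmf) \<Rightarrow> bool" where
  "mechanism Y n R M \<longleftrightarrow> (\<forall>T \<in> lists Y. length T = n \<longrightarrow> M T \<in> dist_on R)"

definition close_dist :: "'r set \<Rightarrow> real \<Rightarrow> real \<Rightarrow> 'r pmf \<Rightarrow> 'r pmf \<Rightarrow> bool" where
  "close_dist R \<epsilon> \<delta> J1 J2 \<longleftrightarrow>
     (\<forall>Q \<subseteq> R.
        measure_pmf.prob J1 Q \<le> exp \<epsilon> * measure_pmf.prob J2 Q + \<delta> \<and>
        measure_pmf.prob J2 Q \<le> exp \<epsilon> * measure_pmf.prob J1 Q + \<delta>)"

definition perfectly_generalizing ::
    "'y set \<Rightarrow> nat \<Rightarrow> 'r set \<Rightarrow> real \<Rightarrow> real \<Rightarrow> real \<Rightarrow> ('y list \<Rightarrow> 'r pmf) \<Rightarrow> bool" where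
  "perfectly_generalizing Y n R \<beta> \<epsilon> \<delta> M \<longleftrightarrow>
     (\<forall>C \<in> dist_on Y. \<exists>Sim \<in> dist_on R.
        measure_pmf.prob (replicate_pmf n C) {T. close_dist R \<epsilon> \<delta> (M T) Sim} \<ge> 1 - \<beta>)"

text \<open>Labels 1 and 0 are \<^const>\<open>True\<close> and \<^const>\<open>False\<close>.\<close>

definition threshold :: "'a::linorder \<Rightarrow> 'a \<Rightarrow> bool" where
  "threshold x = (\<lambda>y. y \<le> x)"

definition thresholds :: "'a::linorder set \<Rightarrow> ('a \<Rightarrow> bool) set" where
  "thresholds X = threshold ` X"

definition err :: "('a \<times> bool) pmf \<Rightarrow> ('a \<Rightarrow> bool) \<Rightarrow> real" where
  "err D h = measure_pmf.prob D {(x, y). h x \<noteq> y}"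

text \<open>
  The probability in the accuracy requirement is taken jointly over the sample and the
  internal randomness of the learner.  \<open>X\<close> is meant to be finite, so that the minimum exists.
\<close>

definition accurate_agnostic_learner ::
    "'a::linorder set \<Rightarrow> nat \<Rightarrow> real \<Rightarrow> real \<Rightarrow> (('a \<times> bool) list \<Rightarrow> ('a \<Rightarrow> bool) pmf) \<Rightarrow> bool" where
  "accurate_agnostic_learner X n \<alpha> \<gamma> M \<longleftrightarrow>
     (\<forall>D \<in> dist_on (X \<times> UNIV).
        measure_pmf.prob (replicate_pmf n D \<bind> M)
          {h. err D h \<le> (MIN f \<in> thresholds X. err D f) + \<alpha>} \<ge> 1 - \<gamma>)"

definition proper_agnostic_learner ::
    "'a::linorder set \<Rightarrow> nat \<Rightarrow> real \<Rightarrow> real \<Rightarrow> (('a \<times> bool) list \<Rightarrow> ('a \<Rightarrow> bool) pmf) \<Rightarrow> bool" where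
  "proper_agnostic_learner X n \<alpha> \<gamma> M \<longleftrightarrow>
     mechanism (X \<times> UNIV) n (thresholds X) M \<and> accurate_agnostic_learner X n \<alpha> \<gamma> M"

end

theory Submission
  imports Defs
begin

text \<open>
  The simulator of a perfectly generalizing mechanism is differentially private: if two
  distributions differ on few points, some typical sample \<open>T\<close> avoids these points and is good for
  both, so both simulators are close to \<open>M T\<close> and hence to each other.  Simulators also inherit the
  accuracy of the learner.  Applied to the distribution that puts mass of order \<open>\<alpha>\<close> on \<open>m\<close> labelled
  data points, with \<open>m\<close> of order \<open>\<alpha> n\<close>, and the remaining mass on the least element labelled \<open>1\<close>,
  this solves the interior point problem privately on \<open>m\<close> points.  By the reduction of
  Bun, Nissim, Stemmer and Vadhan, \<open>m + 1\<close> points over a domain of size \<open>b ^ S\<close> are at least as hard as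
  \<open>m\<close> points over a domain of size \<open>S\<close>, so that \<open>m\<close> must be at least of order \<open>log\<^sup>* |X|\<close>.
\<close>

section \<open>Probabilities of events under mixtures\<close>

lemma measure_bind_pmf:
  "measure_pmf.prob (p \<bind> f) A = (\<integral>x. measure_pmf.prob (f x) A \<partial>measure_pmf p)"
proof -
  have "ennreal (measure_pmf.prob (p \<bind> f) A) = (\<integral>\<^sup>+x. ennreal (measure_pmf.prob (f x) A) \<partial>measure_pmf p)"
    by (simp add: measure_pmf.emeasure_eq_measure[symmetric])
  also have "\<dots> = ennreal (\<integral>x. measure_pmf.prob (f x) A \<partial>measure_pmf p)"
    by (intro nn_integral_eq_integral measure_pmf.integrable_const_bound[where B = 1]) auto
  finally show ?thesis
    by (simp add: integral_nonneg_AE)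
qed

lemma measure_bind_pmf_of_set:
  assumes "finite Y" "Y \<noteq> {}"
  shows "measure_pmf.prob (pmf_of_set Y \<bind> f) A = (\<Sum>y\<in>Y. measure_pmf.prob (f y) A) / card Y"
  using assms by (simp add: measure_bind_pmf integral_pmf_of_set)

subsection \<open>The interior point problem\<close>

definition interior_point :: "nat list \<Rightarrow> nat \<Rightarrow> bool" where
  "interior_point xs z \<longleftrightarrow> (\<exists>x\<in>set xs. x \<le> z) \<and> (\<exists>x\<in>set xs. z \<le> x)"

text \<open>\<open>K\<close> stands for the factor e^\<epsilon>. One inequality suffices because
  exchanging an entry is reversible.\<close>

definition diff_private :: "real \<Rightarrow> real \<Rightarrow> nat \<Rightarrow> nat \<Rightarrow> (nat list \<Rightarrow> nat pmf) \<Rightarrow> bool" where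
  "diff_private K \<delta> m S A \<longleftrightarrow>
     (\<forall>xs v i Q. length xs = m \<longrightarrow> set xs \<subseteq> {..<S} \<longrightarrow> i < m \<longrightarrow> v < S \<longrightarrow>
        measure_pmf.prob (A xs) Q \<le> K * measure_pmf.prob (A (xs[i := v])) Q + \<delta>)"

definition solves_ipp :: "real \<Rightarrow> nat \<Rightarrow> nat \<Rightarrow> (nat list \<Rightarrow> nat pmf) \<Rightarrow> bool" where
  "solves_ipp q m S A \<longleftrightarrow>
     (\<forall>xs. length xs = m \<longrightarrow> set xs \<subseteq> {..<S} \<longrightarrow>
        measure_pmf.prob (A xs) {z. \<not> interior_point xs z} \<le> q)"

section \<open>Base-\<open>b\<close> expansions with \<open>S\<close> digits, counted from the most
  significant one\<close>

definition high_digits :: "nat \<Rightarrow> nat \<Rightarrow> nat \<Rightarrow> nat \<Rightarrow> nat" where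
  "high_digits b S y j = y div b ^ (S - j)"

definition truncate_digits :: "nat \<Rightarrow> nat \<Rightarrow> nat \<Rightarrow> nat \<Rightarrow> nat" where
  "truncate_digits b S y j = high_digits b S y j * b ^ (S - j)"

text \<open>The length of the longest common prefix. An algorithm may output any natural number, and
  for \<open>z \<ge> b ^ S\<close> even \<open>j = 0\<close> can fail; the inserted \<open>0\<close>
  then serves as the default.\<close>

definition overlap :: "nat \<Rightarrow> nat \<Rightarrow> nat \<Rightarrow> nat \<Rightarrow> nat" where
  "overlap b S y z = Max (insert 0 {j. j \<le> S \<and> high_digits b S z j = high_digits b S y j})"

lemma high_digits_high_digits:
  assumes "j \<le> k" "k \<le> S"
  shows "high_digits b S y k div b ^ (k - j) = high_digits b S y j"
proof -
  have "b ^ (S - j) = b ^ (S - k) * b ^ (k - j)"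
    using assms by (simp flip: power_add)
  then show ?thesis by (simp only: high_digits_def div_mult2_eq)
qed

lemma high_digits_mono: "y \<le> z \<Longrightarrow> high_digits b S y j \<le> high_digits b S z j"
  by (simp add: high_digits_def div_le_mono)

lemma high_digits_truncate_digits:
  assumes "b > 0" "j \<le> k" "k \<le> S"
  shows "high_digits b S (truncate_digits b S y k) j = high_digits b S y j"
proof -
  have "high_digits b S (truncate_digits b S y k) k = high_digits b S y k"
    using assms by (simp add: truncate_digits_def high_digits_def)
  then show ?thesis
    by (simp only: high_digits_high_digits[OF assms(2,3), symmetric])
qed

lemma truncate_digits_le: "truncate_digits b S y j \<le> y"
  by (simp add: truncate_digits_def high_digits_def)

lemma truncate_digits_truncate_digits:
  assumes "b > 0" "j \<le> k" "k \<le> S"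
  shows "truncate_digits b S (truncate_digits b S y k) j = truncate_digits b S y j"
  using high_digits_truncate_digits[OF assms] by (simp add: truncate_digits_def)

lemma le_overlap: "j \<le> S \<Longrightarrow> high_digits b S z j = high_digits b S y j \<Longrightarrow> j \<le> overlap b S y z"
  unfolding overlap_def by (intro Max_ge) auto

text \<open>Equal prefixes have equal shorter prefixes, and a positive overlap is a genuine element
  of the set rather than the default \<open>0\<close>.\<close>

lemma high_digits_eq_of_lt_overlap:
  assumes "j < overlap b S y z"
  shows "high_digits b S z (Suc j) = high_digits b S y (Suc j)"
proof -
  let ?J = "{j. j \<le> S \<and> high_digits b S z j = high_digits b S y j}"
  have "overlap b S y z \<in> insert 0 ?J"
    unfolding overlap_def by (rule Max_in) auto
  then have le: "overlap b S y z \<le> S"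
    and eq: "high_digits b S z (overlap b S y z) = high_digits b S y (overlap b S y z)"
    using assms by auto
  show ?thesis
    using eq by (simp only: high_digits_high_digits[OF Suc_leI[OF assms] le, symmetric])
qed

text \<open>The value \<open>z\<close> is squeezed between two entries that share the first
  \<open>Min (set xs)\<close> digits with \<open>y\<close>; prefixes are monotone, so
  \<open>z\<close> shares them too. The mismatch at length \<open>Max (set xs) + 1\<close> bounds
  the overlap from above.\<close>

lemma interior_overlap:
  assumes b: "b > 0" and xs: "set xs \<subseteq> {..<S}" "xs \<noteq> []"
    and int: "interior_point (y # map (truncate_digits b S y) xs) z"
    and digit: "high_digits b S z (Suc (Max (set xs))) \<noteq> high_digits b S y (Suc (Max (set xs)))"
  shows "interior_point xs (overlap b S y z)"
proof -
  define a where "a = Min (set xs)"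
  have a: "a \<in> set xs" "\<And>x. x \<in> set xs \<Longrightarrow> a \<le> x"
    using xs by (auto simp: a_def)
  have same: "high_digits b S u a = high_digits b S y a"
    if "u \<in> set (y # map (truncate_digits b S y) xs)" for u
  proof (cases "u = y")
    case False
    with that obtain x where "x \<in> set xs" "u = truncate_digits b S y x" by auto
    moreover from this have "a \<le> x" "x \<le> S" using a xs(1) by (auto intro: less_imp_le)
    ultimately show ?thesis using b by (simp add: high_digits_truncate_digits)
  qed simp
  obtain u v where uv: "u \<in> set (y # map (truncate_digits b S y) xs)" "u \<le> z"
     "v \<in> set (y # map (truncate_digits b S y) xs)" "z \<le> v"
    using int unfolding interior_point_def by (elim conjE bexE) (rule that)
  have "high_digits b S z a = high_digits b S y a"
    using high_digits_mono[OF uv(2), of b S a] high_digits_mono[OF uv(4), of b S a]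
      same[OF uv(1)] same[OF uv(3)] by simp
  then have "a \<le> overlap b S y z"
    using a xs(1) by (intro le_overlap) auto
  moreover have "overlap b S y z \<le> Max (set xs)"
    using digit high_digits_eq_of_lt_overlap[of "Max (set xs)" b S y z] by (cases "overlap b S y z \<le> Max (set xs)") simp_all
  moreover have "Max (set xs) \<in> set xs"
    using xs by simp
  ultimately show ?thesis
    unfolding interior_point_def using a(1) by blast
qed

text \<open>\<open>P\<close> sees only the first \<open>j\<close> digits of \<open>y\<close>. The
  next digit has \<open>b\<close> equally likely values and guessing them are disjoint events, so
  the average success is at most \<open>1 / b\<close>.\<close>

lemma guess_next_digit:
  assumes b: "b > 0" and j: "j < S"
  shows "(\<Sum>y<b ^ S. measure_pmf.prob (P (truncate_digits b S y j))
           {z. high_digits b S z (Suc j) = high_digits b S y (Suc j)}) \<le> real (b ^ S) / b"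
proof -
  define r where "r = b ^ (S - Suc j)"
  have r: "r > 0" and rS: "b ^ (S - j) = b * r" "b ^ S = (b ^ j * b) * r"
  proof -
    have *: "S - j = Suc (S - Suc j)" "S = j + (S - j)"
      using j by auto
    show "r > 0" using b by (simp add: r_def)
    show "b ^ (S - j) = b * r" unfolding r_def by (subst *(1)) simp
    then show "b ^ S = (b ^ j * b) * r" by (subst *(2)) (simp add: power_add)
  qed
  let ?f = "\<lambda>y. measure_pmf.prob (P (truncate_digits b S y j))
           {z. high_digits b S z (Suc j) = high_digits b S y (Suc j)}"
  \<comment> \<open>Here \<open>t\<close> stands for a prefix of length \<open>j + 1\<close>, shared
    by \<open>r\<close> values of \<open>y\<close>; \<open>t div b\<close> is its prefix of length
    \<open>j\<close>.\<close>
  define g where "g t = measure_pmf.prob (P (t div b * (b * r))) {z. z div r = t}" for t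
  have f_eq: "?f y = g t" if "y \<in> {t * r..<t * r + r}" for y t
  proof -
    have t: "y div r = t"
      using that by (intro div_nat_eqI) (simp_all add: mult.commute[of _ t])
    have "y div (b * r) = t div b"
      by (simp only: mult.commute[of b] div_mult2_eq t)
    then have "truncate_digits b S y j = t div b * (b * r)"
      by (simp only: truncate_digits_def high_digits_def rS)
    with t show ?thesis
      by (simp only: g_def high_digits_def r_def[symmetric])
  qed
  \<comment> \<open>All \<open>t\<close> that extend the same shorter prefix \<open>u\<close> face
    the same distribution, with disjoint events.\<close>
  have block: "sum g {u * b..<u * b + b} \<le> 1" for u
  proof -
    define Q where "Q = P (u * (b * r))"
    have "t div b = u" if "t \<in> {u * b..<u * b + b}" for t
      using that by (intro div_nat_eqI) (simp_all add: mult.commute[of _ u])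
    then have "sum g {u * b..<u * b + b} = (\<Sum>t\<in>{u * b..<u * b + b}. measure_pmf.prob Q {z. z div r = t})"
      by (intro sum.cong refl) (simp only: g_def Q_def)
    also have "\<dots> = measure_pmf.prob Q (\<Union>t\<in>{u * b..<u * b + b}. {z. z div r = t})"
      by (rule measure_pmf.finite_measure_finite_Union[symmetric]) (auto simp: disjoint_family_on_def)
    also have "\<dots> \<le> 1"
      by simp
    finally show ?thesis .
  qed
  have "(\<Sum>y<b ^ S. ?f y) = (\<Sum>t<b ^ j * b. sum ?f {t * r..<t * r + r})"
    unfolding rS by (rule sum.nat_group[symmetric])
  also have "\<dots> = (\<Sum>t<b ^ j * b. \<Sum>y\<in>{t * r..<t * r + r}. g t)"
    by (intro sum.cong refl f_eq)
  also have "\<dots> = real r * sum g {..<b ^ j * b}"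
    by (simp add: sum_distrib_left)
  also have "sum g {..<b ^ j * b} = (\<Sum>u<b ^ j. sum g {u * b..<u * b + b})"
    by (rule sum.nat_group[symmetric])
  also have "\<dots> \<le> (\<Sum>u<b ^ j. 1)"
    by (intro sum_mono block)
  finally have "(\<Sum>y<b ^ S. ?f y) \<le> real r * b ^ j"
    using r by simp
  also have "\<dots> = real (b ^ S) / b"
    using b by (simp add: rS)
  finally show ?thesis .
qed

text \<open>One round of the reduction of Bun, Nissim, Stemmer and Vadhan: a random \<open>y\<close> replaces each
  data point \<open>x\<close> by its first \<open>x\<close> digits, so every interior point of the new data set agrees with
  \<open>y\<close> on the first \<open>Min (set xs)\<close> digits, while digit \<open>Max (set xs) + 1\<close> of \<open>y\<close> occurs only in
  one entry and is therefore hidden from a private algorithm.\<close>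

definition ipp_reduction :: "nat \<Rightarrow> nat \<Rightarrow> (nat list \<Rightarrow> nat pmf) \<Rightarrow> nat list \<Rightarrow> nat pmf" where
  "ipp_reduction b S A xs =
     pmf_of_set {..<b ^ S} \<bind> (\<lambda>y. map_pmf (overlap b S y) (A (y # map (truncate_digits b S y) xs)))"

lemma measure_ipp_reduction:
  assumes "b > 0"
  shows "measure_pmf.prob (ipp_reduction b S A xs) Q =
    (\<Sum>y<b ^ S. measure_pmf.prob (A (y # map (truncate_digits b S y) xs)) (overlap b S y -` Q)) / real (b ^ S)"
  unfolding ipp_reduction_def using assms
  by (subst measure_bind_pmf_of_set) (auto simp: lessThan_empty_iff)

lemma average_le:
  assumes "finite Y" "Y \<noteq> {}" "\<And>y. y \<in> Y \<Longrightarrow> f y \<le> K * g y + (d::real)"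
  shows "sum f Y / card Y \<le> K * (sum g Y / card Y) + d"
proof -
  have "sum f Y \<le> (\<Sum>y\<in>Y. K * g y + d)"
    using assms(3) by (intro sum_mono)
  then have "sum f Y \<le> K * sum g Y + card Y * d"
    by (simp add: sum.distrib sum_distrib_left)
  moreover have "real (card Y) > 0"
    using assms by (simp add: card_gt_0_iff)
  ultimately show ?thesis
    by (simp add: field_simps)
qed

lemma truncate_digits_lt: "y < b ^ S \<Longrightarrow> truncate_digits b S y x < b ^ S"
  using truncate_digits_le by (rule le_less_trans)

text \<open>For each fixed \<open>y\<close>, exchanging entry \<open>i\<close> of \<open>xs\<close>
  exchanges only entry \<open>i + 1\<close> of the new data set, and averaging over \<open>y\<close>
  preserves the inequality.\<close>

lemma diff_private_ipp_reduction:
  assumes b: "b > 0" and A: "diff_private K \<delta> (Suc m) (b ^ S) A"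
  shows "diff_private K \<delta> m S (ipp_reduction b S A)"
  unfolding diff_private_def
proof (intro allI impI)
  fix xs :: "nat list" and v i Q
  assume xs: "length xs = m" "set xs \<subseteq> {..<S}" and i: "i < m" "v < S"
  let ?T = "\<lambda>y xs. y # map (truncate_digits b S y) xs"
  let ?p = "\<lambda>xs y. measure_pmf.prob (A (?T y xs)) (overlap b S y -` Q)"
  have step: "?p xs y \<le> K * ?p (xs[i := v]) y + \<delta>" if "y \<in> {..<b ^ S}" for y
  proof -
    have "(?T y xs)[Suc i := truncate_digits b S y v] = ?T y (xs[i := v])"
      by (simp add: map_update)
    moreover have "length (?T y xs) = Suc m" "set (?T y xs) \<subseteq> {..<b ^ S}" "Suc i < Suc m"
      using xs i that by (auto simp: truncate_digits_lt)
    ultimately show ?thesis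
      using A truncate_digits_lt[of y b S v] that unfolding diff_private_def
      by (metis lessThan_iff)
  qed
  have "sum (?p xs) {..<b ^ S} / card {..<b ^ S} \<le> K * (sum (?p (xs[i := v])) {..<b ^ S} / card {..<b ^ S}) + \<delta>"
    using b by (intro average_le step) (auto simp: lessThan_empty_iff)
  then show "measure_pmf.prob (ipp_reduction b S A xs) Q
      \<le> K * measure_pmf.prob (ipp_reduction b S A (xs[i := v])) Q + \<delta>"
    by (simp only: measure_ipp_reduction[OF b] card_lessThan)
qed

text \<open>Failure implies that \<open>A\<close> fails, or that its output agrees with
  \<open>y\<close> on the first \<open>c + 1\<close> digits. Erasing all digits after the first
  \<open>c\<close> from the leading entry costs \<open>K\<close> and \<open>\<delta>\<close> by
  privacy; afterwards the input depends only on the first \<open>c\<close> digits, and digit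
  \<open>c + 1\<close> can only be guessed.\<close>

lemma solves_ipp_reduction:
  assumes b: "b > 0" and m: "m > 0" and K: "K \<ge> 0"
    and A: "diff_private K \<delta> (Suc m) (b ^ S) A" "solves_ipp q (Suc m) (b ^ S) A"
  shows "solves_ipp (q + K / b + \<delta>) m S (ipp_reduction b S A)"
  unfolding solves_ipp_def
proof (intro allI impI)
  fix xs :: "nat list"
  assume xs: "length xs = m" "set xs \<subseteq> {..<S}"
  define c where "c = Max (set xs)"
  have "xs \<noteq> []" using xs m by auto
  then have "c \<in> set xs" unfolding c_def by simp
  then have c: "c < S" and le_c: "\<And>x. x \<in> set xs \<Longrightarrow> x \<le> c"
    using xs by (auto simp: c_def)
  let ?xs = "\<lambda>y. map (truncate_digits b S y) xs"
  let ?E = "\<lambda>y. {z. high_digits b S z (Suc c) = high_digits b S y (Suc c)}"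
  define P where "P t = A (t # ?xs t)" for t
  \<comment> \<open>Every data point is at most \<open>c\<close>, so erasing later digits of
    \<open>y\<close> leaves all entries but the leading one unchanged.\<close>
  have xs_trunc: "?xs (truncate_digits b S y c) = ?xs y" for y
    using truncate_digits_truncate_digits[OF b] le_c c by simp
  have bound: "measure_pmf.prob (A (y # ?xs y)) (overlap b S y -` {z. \<not> interior_point xs z})
      \<le> K * measure_pmf.prob (P (truncate_digits b S y c)) (?E y) + (q + \<delta>)"
    if "y \<in> {..<b ^ S}" for y
  proof -
    let ?Y = "y # ?xs y"
    have Y: "length ?Y = Suc m" "set ?Y \<subseteq> {..<b ^ S}" "0 < Suc m" "truncate_digits b S y c < b ^ S"
      using xs that by (auto simp: truncate_digits_lt)
    have "overlap b S y -` {z. \<not> interior_point xs z} \<subseteq> {z. \<not> interior_point ?Y z} \<union> ?E y"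
      using interior_overlap[OF b xs(2) \<open>xs \<noteq> []\<close>, of y] by (auto simp: c_def)
    then have "measure_pmf.prob (A ?Y) (overlap b S y -` {z. \<not> interior_point xs z})
      \<le> measure_pmf.prob (A ?Y) ({z. \<not> interior_point ?Y z} \<union> ?E y)"
      by (rule measure_pmf.finite_measure_mono) simp
    also have "\<dots> \<le> measure_pmf.prob (A ?Y) {z. \<not> interior_point ?Y z} + measure_pmf.prob (A ?Y) (?E y)"
      by (rule measure_Un_le) auto
    also have "measure_pmf.prob (A ?Y) {z. \<not> interior_point ?Y z} \<le> q"
      using A(2) Y unfolding solves_ipp_def by blast
    also have "measure_pmf.prob (A ?Y) (?E y)
        \<le> K * measure_pmf.prob (A (?Y[0 := truncate_digits b S y c])) (?E y) + \<delta>"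
      using A(1) Y unfolding diff_private_def by blast
    also have "?Y[0 := truncate_digits b S y c] = truncate_digits b S y c # ?xs (truncate_digits b S y c)"
      by (simp only: xs_trunc list_update_code)
    finally show ?thesis by (simp add: P_def)
  qed
  let ?g = "\<lambda>y. measure_pmf.prob (P (truncate_digits b S y c)) (?E y)"
  let ?f = "\<lambda>y. measure_pmf.prob (A (y # ?xs y)) (overlap b S y -` {z. \<not> interior_point xs z})"
  have "sum ?f {..<b ^ S} / card {..<b ^ S} \<le> K * (sum ?g {..<b ^ S} / card {..<b ^ S}) + (q + \<delta>)"
    by (intro average_le bound) (use b in \<open>simp_all add: lessThan_empty_iff\<close>)
  then have "measure_pmf.prob (ipp_reduction b S A xs) {z. \<not> interior_point xs z}
      \<le> K * (sum ?g {..<b ^ S} / card {..<b ^ S}) + (q + \<delta>)"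
    by (simp only: measure_ipp_reduction[OF b] card_lessThan)
  also have "sum ?g {..<b ^ S} / card {..<b ^ S} \<le> 1 / b"
    using guess_next_digit[OF b c, of P] b by (simp add: field_simps)
  finally show "measure_pmf.prob (ipp_reduction b S A xs) {z. \<not> interior_point xs z} \<le> q + K / b + \<delta>"
    using K by (simp add: mult_left_mono)
qed

section \<open>Iterating the reduction down to a domain of two values\<close>

primrec ipp_domain_size :: "nat \<Rightarrow> nat \<Rightarrow> nat" where
  "ipp_domain_size b 0 = 2"
| "ipp_domain_size b (Suc j) = b ^ ipp_domain_size b j"

text \<open>Each round removes one data point, takes a logarithm of the domain size and adds
  \<open>K / b + \<delta>\<close> to the failure probability. In the end a single point over two
  values remains: the output must equal the input, which conflicts with privacy between
  \<open>[0]\<close> and \<open>[1]\<close>.\<close>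

lemma private_ipp_lower_bound:
  assumes b: "b > 0" and K: "K \<ge> 0"
    and "diff_private K \<delta> (Suc j) (ipp_domain_size b j) A"
    and "solves_ipp q (Suc j) (ipp_domain_size b j) A"
  shows "1 \<le> (1 + K) * (q + j * (K / b + \<delta>)) + \<delta>"
  using assms(3,4)
proof (induction j arbitrary: A q)
  case 0
  let ?p = "\<lambda>x. measure_pmf.prob (A [x])"
  have q: "?p x {z. z \<noteq> x} \<le> q" if "x < 2" for x
  proof -
    have "{z. \<not> interior_point [x] z} = {z. z \<noteq> x}"
      by (auto simp: interior_point_def)
    then show ?thesis
      using 0(2)[unfolded solves_ipp_def, rule_format, of "[x]"] that by simp
  qed
  have "1 - q \<le> ?p 0 {z. z = 0}"
    using q[of 0] measure_pmf.prob_neg[of "A [0]" "\<lambda>z. z = 0"] by simp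
  also have "\<dots> \<le> K * ?p 1 {z. z = 0} + \<delta>"
    using 0(1)[unfolded diff_private_def, rule_format, of "[0]" 0 1] by simp
  also have "?p 1 {z. z = 0} \<le> ?p 1 {z. z \<noteq> 1}"
    by (rule measure_pmf.finite_measure_mono) auto
  also have "\<dots> \<le> q"
    using q by simp
  finally have "1 - q \<le> K * q + \<delta>"
    using K by (simp add: mult_left_mono)
  then show ?case by (simp add: algebra_simps)
next
  case (Suc j)
  have "1 \<le> (1 + K) * ((q + K / b + \<delta>) + j * (K / b + \<delta>)) + \<delta>"
    using Suc.prems by (intro Suc.IH[of "ipp_reduction b (ipp_domain_size b j) A"]
        diff_private_ipp_reduction solves_ipp_reduction b K) simp_all
  also have "(q + K / b + \<delta>) + j * (K / b + \<delta>) = q + Suc j * (K / b + \<delta>)"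
    by (simp add: distrib_right)
  finally show ?case .
qed

subsection \<open>Towers and the iterated logarithm\<close>

primrec tower :: "nat \<Rightarrow> nat" where
  "tower 0 = 1"
| "tower (Suc k) = 2 ^ tower k"

lemma less_tower: "k < tower k"
proof (induction k)
  case (Suc k)
  then have "Suc k \<le> tower k" by simp
  also have "tower k < 2 ^ tower k" by simp
  finally show ?case by simp
qed simp

lemma double_le_power2: "c > 0 \<Longrightarrow> 2 * c \<le> (2::nat) ^ c"
proof (induction c)
  case (Suc c)
  then show ?case by (cases "c = 0") auto
qed simp

text \<open>The factor \<open>2 * c\<close> makes the induction work: with \<open>S\<close> the
  previous size, \<open>(2 * c) ^ (S + 1) \<le> 2 ^ (c * (S + 1)) \<le> 2 ^ (2 * c * S)\<close>, and
  the last exponent is what the induction hypothesis bounds.\<close>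

lemma ipp_domain_size_le_tower:
  assumes "c > 0"
  shows "2 * c * ipp_domain_size (2 * c) j \<le> tower (4 * c + j)"
proof (induction j)
  case 0
  show ?case using less_tower[of "4 * c"] by simp
next
  case (Suc j)
  let ?S = "ipp_domain_size (2 * c) j"
  have "?S > 0" using assms by (induction j) auto
  have "2 * c * ipp_domain_size (2 * c) (Suc j) = (2 * c) ^ Suc ?S"
    by simp
  also have "\<dots> \<le> (2 ^ c) ^ Suc ?S"
    by (intro power_mono double_le_power2 assms) simp
  also have "\<dots> = 2 ^ (c * Suc ?S)"
    by (simp only: power_mult)
  also have "\<dots> \<le> 2 ^ (2 * c * ?S)"
    using \<open>?S > 0\<close> by (intro power_increasing) simp_all
  also have "\<dots> \<le> 2 ^ tower (4 * c + j)"
    using Suc.IH by (intro power_increasing) simp_all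
  finally show ?case by simp
qed

lemma log_star_le:
  fixes x :: real
  assumes "x \<le> tower k"
  shows "log_star x \<le> k"
proof -
  have "\<exists>j\<le>k. (log 2 ^^ j) x \<le> 1"
    using assms
  proof (induction k arbitrary: x)
    case 0
    then show ?case by auto
  next
    case (Suc k)
    show ?case
    proof (cases "x \<le> 1")
      case True
      then show ?thesis by (intro exI[of _ 0]) simp
    next
      case False
      then have "log 2 x \<le> log 2 (2 ^ tower k)"
        using Suc.prems by (subst log_le_cancel_iff) simp_all
      then have "log 2 x \<le> tower k" by (simp add: log_nat_power)
      from Suc.IH[OF this] obtain j where "j \<le> k" "(log 2 ^^ j) (log 2 x) \<le> 1" by blast
      then show ?thesis by (intro exI[of _ "Suc j"]) (simp only: funpow_Suc_right o_apply Suc_le_mono)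
    qed
  qed
  then obtain j where "j \<le> k" "(log 2 ^^ j) x \<le> 1" by blast
  then show ?thesis
    unfolding log_star_def using Least_le[of "\<lambda>k. (log 2 ^^ k) x \<le> 1" j] by simp
qed

subsection \<open>Simulators\<close>

lemma measure_pmf_cong_on:
  assumes "\<And>x. x \<in> A \<Longrightarrow> pmf p x = pmf q x"
  shows "measure_pmf.prob p A = measure_pmf.prob q A"
  using assms by (simp add: measure_pmf_conv_infsetsum cong: infsetsum_cong)

lemma pmf_map_Cons:
  "pmf (map_pmf ((#) x) p) ys = (if ys \<noteq> [] \<and> hd ys = x then pmf p (tl ys) else 0)"
proof (cases "ys \<noteq> [] \<and> hd ys = x")
  case True
  then have "ys = x # tl ys" by (metis list.collapse)
  then have "pmf (map_pmf ((#) x) p) ys = pmf (map_pmf ((#) x) p) (x # tl ys)" by simp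
  also have "\<dots> = pmf p (tl ys)"
    by (rule pmf_map_inj') simp
  finally show ?thesis using True by simp
next
  case False
  then show ?thesis by (auto simp: pmf_eq_0_set_pmf)
qed

lemma pmf_replicate_pmf:
  "pmf (replicate_pmf n p) xs = (if length xs = n then prod_list (map (pmf p) xs) else 0)"
proof (induction n arbitrary: xs)
  case 0
  then show ?case by (simp add: pmf_return)
next
  case (Suc n)
  have "pmf (replicate_pmf (Suc n) p) xs = (\<integral>x. pmf (map_pmf ((#) x) (replicate_pmf n p)) xs \<partial>measure_pmf p)"
    by (simp add: pmf_bind map_pmf_def)
  also have "\<dots> = (if length xs = Suc n then prod_list (map (pmf p) xs) else 0)"
  proof (cases xs)
    case Nil
    then show ?thesis by (simp add: pmf_map_Cons)
  next
    case (Cons y ys)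
    then have "(\<integral>x. pmf (map_pmf ((#) x) (replicate_pmf n p)) xs \<partial>measure_pmf p)
      = (\<integral>x. indicator {y} x * pmf (replicate_pmf n p) ys \<partial>measure_pmf p)"
      by (intro Bochner_Integration.integral_cong refl) (auto simp: pmf_map_Cons indicator_def)
    also have "\<dots> = measure_pmf.prob p {y} * pmf (replicate_pmf n p) ys"
      by (subst integral_mult_left_zero) (simp only: Bochner_Integration.integral_indicator, simp)
    finally show ?thesis
      using Cons by (simp add: Suc.IH measure_pmf_single)
  qed
  finally show ?case .
qed

text \<open>Union bound over the entries: \<open>- lists E\<close> is the event that some entry lies
  outside \<open>E\<close>.\<close>

lemma prob_replicate_pmf_not_lists:
  "measure_pmf.prob (replicate_pmf n p) (- lists E) \<le> n * measure_pmf.prob p (- E)"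
proof (induction n)
  case 0
  then show ?case by simp
next
  case (Suc n)
  let ?P = "measure_pmf.prob (replicate_pmf n p)"
  have "measure_pmf.prob (replicate_pmf (Suc n) p) (- lists E)
    = (\<integral>x. measure_pmf.prob (map_pmf ((#) x) (replicate_pmf n p)) (- lists E) \<partial>measure_pmf p)"
    by (simp add: measure_bind_pmf map_pmf_def)
  also have "\<dots> \<le> (\<integral>x. indicator (- E) x + ?P (- lists E) \<partial>measure_pmf p)"
  proof (rule integral_mono)
    fix x
    show "measure_pmf.prob (map_pmf ((#) x) (replicate_pmf n p)) (- lists E) \<le> indicator (- E) x + ?P (- lists E)"
    proof (cases "x \<in> E")
      case True
      then have "(#) x -` (- lists E) = - lists E" by auto
      then show ?thesis by simp
    next
      case False
      then show ?thesis by (simp add: add_increasing2)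
    qed
  qed (auto intro!: measure_pmf.integrable_const_bound[where B = 1] Bochner_Integration.integrable_add
         simp: indicator_def)
  also have "\<dots> = measure_pmf.prob p (- E) + ?P (- lists E)"
    by (subst Bochner_Integration.integral_add)
       (auto intro!: measure_pmf.integrable_const_bound[where B = 1] simp: indicator_def)
  also have "\<dots> \<le> measure_pmf.prob p (- E) + n * measure_pmf.prob p (- E)"
    using Suc.IH by simp
  finally show ?case by (simp add: algebra_simps)
qed

text \<open>A sample that avoids the points on which \<open>C\<close> and \<open>C'\<close> differ is equally likely under both.\<close>

lemma exists_common_good_sample:
  assumes eq: "\<And>z. z \<in> E \<Longrightarrow> pmf C z = pmf C' z"
    and avoid: "n * measure_pmf.prob C (- E) \<le> 1 / 2"
    and G: "measure_pmf.prob (replicate_pmf n C) G \<ge> 1 - \<beta>"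
    and G': "measure_pmf.prob (replicate_pmf n C') G' \<ge> 1 - \<beta>"
    and "\<beta> < 1 / 4"
  shows "\<exists>T. T \<in> G \<and> T \<in> G'"
proof (rule ccontr)
  let ?P = "measure_pmf.prob (replicate_pmf n C)" and ?P' = "measure_pmf.prob (replicate_pmf n C')"
  assume "\<nexists>T. T \<in> G \<and> T \<in> G'"
  \<comment> \<open>Without a common good sample these three events cover everything, although their
    probabilities add up to at most \<open>1 / 2 + 2 * \<beta> < 1\<close>.\<close>
  then have "UNIV \<subseteq> - lists E \<union> (- G \<union> (lists E - G'))" by auto
  then have "?P UNIV \<le> ?P (- lists E \<union> (- G \<union> (lists E - G')))"
    by (rule measure_pmf.finite_measure_mono) simp
  also have "\<dots> \<le> ?P (- lists E) + (?P (- G) + ?P (lists E - G'))"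
    by (intro order.trans[OF measure_Un_le] add_left_mono) simp_all
  also have "?P (- lists E) \<le> 1 / 2"
    using prob_replicate_pmf_not_lists[of n C E] avoid by simp
  also have "?P (- G) \<le> \<beta>"
    using G measure_pmf.prob_compl[of G "replicate_pmf n C"] by (simp add: Compl_eq_Diff_UNIV)
  also have "?P (lists E - G') = ?P' (lists E - G')"
  proof (rule measure_pmf_cong_on)
    fix T assume "T \<in> lists E - G'"
    then have "map (pmf C) T = map (pmf C') T" using eq by auto
    then show "pmf (replicate_pmf n C) T = pmf (replicate_pmf n C') T"
      by (simp only: pmf_replicate_pmf)
  qed
  also have "?P' (lists E - G') \<le> ?P' (- G')"
    by (rule measure_pmf.finite_measure_mono) auto
  also have "\<dots> \<le> \<beta>"
    using G' measure_pmf.prob_compl[of G' "replicate_pmf n C'"] by (simp add: Compl_eq_Diff_UNIV)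
  finally show False using \<open>\<beta> < 1 / 4\<close> by simp
qed

text \<open>Makes closeness, which tests only subsets of \<open>R\<close>, available for arbitrary
  events.\<close>

lemma prob_dist_on_Int: "p \<in> dist_on R \<Longrightarrow> measure_pmf.prob p (Q \<inter> R) = measure_pmf.prob p Q"
  unfolding dist_on_def using measure_Int_set_pmf[of p "Q \<inter> R"] measure_Int_set_pmf[of p Q]
  by (simp add: Int_assoc Int_absorb1 inf_absorb2)

text \<open>A triangle inequality through \<open>J\<close>: the factors multiply, and the inner
  \<open>\<delta>\<close> is scaled by \<open>exp \<epsilon>\<close>.\<close>

lemma simulators_close:
  assumes "close_dist R \<epsilon> \<delta> J S" "close_dist R \<epsilon> \<delta> J S'" "S \<in> dist_on R" "S' \<in> dist_on R"
  shows "measure_pmf.prob S Q \<le> exp (2 * \<epsilon>) * measure_pmf.prob S' Q + (1 + exp \<epsilon>) * \<delta>"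
proof -
  have "measure_pmf.prob S (Q \<inter> R) \<le> exp \<epsilon> * measure_pmf.prob J (Q \<inter> R) + \<delta>"
    using assms(1) by (simp add: close_dist_def)
  also have "measure_pmf.prob J (Q \<inter> R) \<le> exp \<epsilon> * measure_pmf.prob S' (Q \<inter> R) + \<delta>"
    using assms(2) by (simp add: close_dist_def)
  finally have *: "measure_pmf.prob S Q \<le> exp \<epsilon> * (exp \<epsilon> * measure_pmf.prob S' Q + \<delta>) + \<delta>"
    using assms(3,4) by (simp add: prob_dist_on_Int)
  have "exp (2 * \<epsilon>) = exp \<epsilon> * exp \<epsilon>"
    by (simp flip: exp_add)
  with * show ?thesis
    by (simp add: algebra_simps)
qed

text \<open>A Markov-type argument: on at least half of the samples \<open>M T\<close> hits
  \<open>B\<close> with probability at least \<open>\<theta>\<close>, hence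
  \<open>\<theta> / 2 \<le> \<gamma>\<close>.\<close>

lemma simulator_prob_le:
  assumes G: "measure_pmf.prob P {T. close_dist R \<epsilon> \<delta> (M T) S} \<ge> 1 / 2"
    and B: "B \<subseteq> R" "measure_pmf.prob (P \<bind> M) B \<le> \<gamma>"
    and "\<gamma> \<ge> 0" "\<delta> \<ge> 0"
  shows "measure_pmf.prob S B \<le> 2 * exp \<epsilon> * \<gamma> + \<delta>"
proof (cases "measure_pmf.prob S B \<le> \<delta>")
  case True
  then show ?thesis using assms(4) by (simp add: add_increasing)
next
  case False
  let ?G = "{T. close_dist R \<epsilon> \<delta> (M T) S}"
  define \<theta> where "\<theta> = (measure_pmf.prob S B - \<delta>) / exp \<epsilon>"
  have "\<theta> \<ge> 0" using False by (simp add: \<theta>_def)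
  have "\<theta> * (1 / 2) \<le> \<theta> * measure_pmf.prob P ?G"
    using G \<open>\<theta> \<ge> 0\<close> by (intro mult_left_mono)
  also have "\<dots> = (\<integral>T. \<theta> * indicator ?G T \<partial>measure_pmf P)"
    by simp
  also have "\<dots> \<le> (\<integral>T. measure_pmf.prob (M T) B \<partial>measure_pmf P)"
  proof (rule integral_mono)
    fix T
    show "\<theta> * indicator ?G T \<le> measure_pmf.prob (M T) B"
    proof (cases "T \<in> ?G")
      case True
      then have "measure_pmf.prob S B \<le> exp \<epsilon> * measure_pmf.prob (M T) B + \<delta>"
        using B(1) by (simp add: close_dist_def)
      then show ?thesis using True by (simp add: \<theta>_def field_simps)
    qed simp
  qed (auto intro!: measure_pmf.integrable_const_bound[where B = 1] integrable_mult_right simp: indicator_def)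
  also have "\<dots> = measure_pmf.prob (P \<bind> M) B"
    by (simp add: measure_bind_pmf)
  finally have "\<theta> \<le> 2 * \<gamma>" using B(2) by simp
  then show ?thesis by (simp add: \<theta>_def field_simps)
qed

subsection \<open>From learners to private interior point algorithms\<close>

definition labelled_dist :: "real \<Rightarrow> 'z \<Rightarrow> 'z set \<Rightarrow> 'z pmf" where
  "labelled_dist lam a W = bernoulli_pmf lam \<bind> (\<lambda>c. if c then pmf_of_set W else return_pmf a)"

lemma prob_labelled_dist:
  assumes "0 \<le> lam" "lam \<le> 1" "finite W" "W \<noteq> {}"
  shows "measure_pmf.prob (labelled_dist lam a W) Q
    = lam * (card (W \<inter> Q) / card W) + (1 - lam) * indicator Q a"
  using assms by (simp add: labelled_dist_def measure_bind_pmf measure_pmf_of_set)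

lemma set_pmf_labelled_dist:
  assumes "finite W" "W \<noteq> {}"
  shows "set_pmf (labelled_dist lam a W) \<subseteq> insert a W"
  using assms by (auto simp: labelled_dist_def set_pmf_of_set[OF assms(2,1)] split: if_splits)

text \<open>Supplies the pointwise agreement demanded by \<open>exists_common_good_sample\<close>;
  equal cardinalities give the points of \<open>W\<close> and \<open>W'\<close> the same
  mass.\<close>

lemma pmf_labelled_dist_cong:
  assumes "0 \<le> lam" "lam \<le> 1" "finite W" "W \<noteq> {}" "finite W'" "W' \<noteq> {}" "card W = card W'"
    and "z \<in> W \<longleftrightarrow> z \<in> W'"
  shows "pmf (labelled_dist lam a W) z = pmf (labelled_dist lam a W') z"
proof -
  have "W \<inter> {z} = W' \<inter> {z}" using assms(8) by auto
  then show ?thesis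
    unfolding measure_pmf_single[symmetric] using assms(1-7) by (simp add: prob_labelled_dist)
qed

lemma finite_linorder_enumeration:
  fixes X :: "'a::linorder set"
  assumes "finite X"
  obtains e :: "nat \<Rightarrow> 'a"
  where "bij_betw e {..<card X} X" "\<And>i j. i < card X \<Longrightarrow> j < card X \<Longrightarrow> e i \<le> e j \<longleftrightarrow> i \<le> j"
proof
  let ?L = "sorted_list_of_set X"
  have L: "length ?L = card X" "set ?L = X" "distinct ?L" "sorted_wrt (<) ?L"
    using assms by simp_all
  show "bij_betw ((!) ?L) {..<card X} X"
    using bij_betw_nth[OF L(3), of "{..<card X}" X] L by simp
  show "?L ! i \<le> ?L ! j \<longleftrightarrow> i \<le> j" if "i < card X" "j < card X" for i j
  proof (cases i j rule: linorder_cases)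
    case less
    then have "?L ! i < ?L ! j" using L(1) that by (intro sorted_wrt_nth_less[OF L(4)]) simp_all
    then show ?thesis using less by simp
  next
    case greater
    then have "?L ! j < ?L ! i" using L(1) that by (intro sorted_wrt_nth_less[OF L(4)]) simp_all
    then show ?thesis using greater by simp
  qed simp
qed

lemma perfectly_generalizing_mono:
  assumes "perfectly_generalizing Y n R \<beta> \<epsilon> \<delta> M" "\<beta> \<le> \<beta>'" "\<delta> \<le> \<delta>'"
  shows "perfectly_generalizing Y n R \<beta>' \<epsilon> \<delta>' M"
  unfolding perfectly_generalizing_def
proof
  fix C assume "C \<in> dist_on Y"
  then obtain Sim where Sim: "Sim \<in> dist_on R"
    "measure_pmf.prob (replicate_pmf n C) {T. close_dist R \<epsilon> \<delta> (M T) Sim} \<ge> 1 - \<beta>"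
    using assms(1) unfolding perfectly_generalizing_def by blast
  have "close_dist R \<epsilon> \<delta>' J1 J2" if "close_dist R \<epsilon> \<delta> J1 J2" for J1 J2
    unfolding close_dist_def
  proof (intro allI impI)
    fix Q assume "Q \<subseteq> R"
    then have "measure_pmf.prob J1 Q \<le> exp \<epsilon> * measure_pmf.prob J2 Q + \<delta>"
      "measure_pmf.prob J2 Q \<le> exp \<epsilon> * measure_pmf.prob J1 Q + \<delta>"
      using that unfolding close_dist_def by simp_all
    then show "measure_pmf.prob J1 Q \<le> exp \<epsilon> * measure_pmf.prob J2 Q + \<delta>' \<and>
      measure_pmf.prob J2 Q \<le> exp \<epsilon> * measure_pmf.prob J1 Q + \<delta>'"
      using assms(3) by linarith
  qed
  then have "measure_pmf.prob (replicate_pmf n C) {T. close_dist R \<epsilon> \<delta> (M T) Sim}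
    \<le> measure_pmf.prob (replicate_pmf n C) {T. close_dist R \<epsilon> \<delta>' (M T) Sim}"
    by (intro measure_pmf.finite_measure_mono) auto
  then show "\<exists>Sim\<in>dist_on R. 1 - \<beta>' \<le> measure_pmf.prob (replicate_pmf n C) {T. close_dist R \<epsilon> \<delta>' (M T) Sim}"
    using Sim assms(2) by (intro bexI[of _ Sim]) auto
qed

section \<open>Ranks in a finite set of natural numbers\<close>

definition rank_in :: "nat set \<Rightarrow> nat \<Rightarrow> nat" where
  "rank_in P y = card {z \<in> P. z < y}"

lemma rank_in_mono: "finite P \<Longrightarrow> y \<le> y' \<Longrightarrow> rank_in P y \<le> rank_in P y'"
  unfolding rank_in_def by (intro card_mono) auto

lemma rank_in_less: "finite P \<Longrightarrow> y \<in> P \<Longrightarrow> y < y' \<Longrightarrow> rank_in P y < rank_in P y'"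
  unfolding rank_in_def by (intro psubset_card_mono) auto

lemma bij_betw_rank_in:
  assumes "finite P"
  shows "bij_betw (rank_in P) P {..<card P}"
proof -
  have inj: "inj_on (rank_in P) P"
    using rank_in_less[OF assms] by (intro inj_onI) (metis less_irrefl linorder_neqE_nat)
  have "rank_in P ` P \<subseteq> {..<card P}"
  proof (intro image_subsetI lessThan_iff[THEN iffD2])
    fix y assume "y \<in> P"
    then show "rank_in P y < card P"
      unfolding rank_in_def using assms by (intro psubset_card_mono) auto
  qed
  then have "rank_in P ` P = {..<card P}"
    using inj by (intro card_subset_eq) (simp_all add: card_image)
  with inj show ?thesis by (simp add: bij_betw_def)
qed

lemma card_rank_in:
  assumes "finite P"
  shows "card {y \<in> P. rank_in P y \<in> I} = card ({..<card P} \<inter> I)"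
proof -
  have "bij_betw (rank_in P) {y \<in> P. rank_in P y \<in> I} ({..<card P} \<inter> I)"
    using bij_betw_rank_in[OF assms] by (rule bij_betw_subset) (use bij_betw_rank_in[OF assms] in \<open>auto simp: bij_betw_def\<close>)
  then show ?thesis by (rule bij_betw_same_card)
qed

lemma rank_in_insert_le:
  assumes "finite P'" "P \<subseteq> insert u P'"
  shows "rank_in P y \<le> Suc (rank_in P' y)"
proof -
  have "rank_in P y \<le> card (insert u {z \<in> P'. z < y})"
    unfolding rank_in_def using assms by (intro card_mono) auto
  also have "\<dots> \<le> Suc (rank_in P' y)"
    unfolding rank_in_def using assms(1) by (simp add: card_insert_if)
  finally show ?thesis .
qed

lemma exp_small_le: "exp (1/4 :: real) \<le> 3 / 2" "exp (1/8 :: real) \<le> 5 / 4"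
  using exp_bound[of "1/4 :: real"] exp_bound[of "1/8 :: real"] by (simp_all add: power2_eq_square)

text \<open>\<open>lam\<close> is the mass of the informative points and \<open>e\<close> the
  increasing enumeration of \<open>X\<close>. The bound on \<open>n * \<delta>\<close> pays for a
  loss of order \<open>\<delta>\<close> in each of O(n) rounds of the reduction.\<close>

locale generalizing_learner =
  fixes X :: "'a::linorder set" and n :: nat and \<alpha> \<beta> \<delta> lam :: real
    and M :: "('a \<times> bool) list \<Rightarrow> ('a \<Rightarrow> bool) pmf" and e :: "nat \<Rightarrow> 'a"
  assumes e_bij: "bij_betw e {..<card X} X"
    and e_le: "\<And>i j. i < card X \<Longrightarrow> j < card X \<Longrightarrow> e i \<le> e j \<longleftrightarrow> i \<le> j"
    and card_X: "card X \<ge> 2"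
    and alpha: "0 < \<alpha>" "2 * \<alpha> < lam" "lam \<le> 1"
    and beta: "\<beta> < 1 / 4"
    and delta: "0 \<le> \<delta>" "\<delta> \<le> 1 / 10000" "n * \<delta> \<le> 1 / 10000"
    and learner: "proper_agnostic_learner X n \<alpha> (1/32) M"
    and generalizing: "perfectly_generalizing (X \<times> UNIV) n (thresholds X) \<beta> (1/8) \<delta> M"
begin

text \<open>The point \<open>(e 0, True)\<close> is classified correctly by every threshold, so a proper learner can
  only err on \<open>W\<close>, where excess error \<open>\<alpha> < lam / 2\<close> means being wrong on fewer than half of the points.\<close>

definition D :: "('a \<times> bool) set \<Rightarrow> ('a \<times> bool) pmf" where
  "D W = labelled_dist lam (e 0, True) W"

text \<open>Fixing one simulator per distribution turns the simulators into an algorithm whose input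
  is the distribution itself.\<close>

definition sim :: "('a \<times> bool) pmf \<Rightarrow> ('a \<Rightarrow> bool) pmf" where
  "sim C = (SOME S. S \<in> dist_on (thresholds X) \<and>
     measure_pmf.prob (replicate_pmf n C) {T. close_dist (thresholds X) (1/8) \<delta> (M T) S} \<ge> 1 - \<beta>)"

lemma sim:
  assumes "C \<in> dist_on (X \<times> UNIV)"
  shows "sim C \<in> dist_on (thresholds X)"
    and "measure_pmf.prob (replicate_pmf n C) {T. close_dist (thresholds X) (1/8) \<delta> (M T) (sim C)} \<ge> 1 - \<beta>"
proof -
  have "\<exists>S. S \<in> dist_on (thresholds X) \<and>
     measure_pmf.prob (replicate_pmf n C) {T. close_dist (thresholds X) (1/8) \<delta> (M T) S} \<ge> 1 - \<beta>"
    using generalizing assms unfolding perfectly_generalizing_def by blast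
  from someI_ex[OF this] show "sim C \<in> dist_on (thresholds X)"
    "measure_pmf.prob (replicate_pmf n C) {T. close_dist (thresholds X) (1/8) \<delta> (M T) (sim C)} \<ge> 1 - \<beta>"
    unfolding sim_def by auto
qed

lemma e_in_X: "i < card X \<Longrightarrow> e i \<in> X"
  using e_bij by (auto simp: bij_betw_def)

lemma e_eq: "i < card X \<Longrightarrow> j < card X \<Longrightarrow> e i = e j \<longleftrightarrow> i = j"
  using e_bij by (auto simp: bij_betw_def inj_on_def)

lemma finite_X: "finite X"
  using card_X by (intro card_ge_0_finite) simp

lemma thresholdsE:
  assumes "h \<in> thresholds X"
  obtains t where "t < card X" "\<And>i. i < card X \<Longrightarrow> h (e i) \<longleftrightarrow> i \<le> t"
proof -
  obtain x where "x \<in> X" "h = threshold x" using assms by (auto simp: thresholds_def)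
  moreover from this obtain t where "t < card X" "x = e t"
    using e_bij by (auto simp: bij_betw_def)
  ultimately show thesis by (intro that[of t]) (simp_all add: threshold_def e_le)
qed

lemma D_in_dist_on: "finite W \<Longrightarrow> W \<noteq> {} \<Longrightarrow> W \<subseteq> X \<times> UNIV \<Longrightarrow> D W \<in> dist_on (X \<times> UNIV)"
  unfolding D_def dist_on_def using set_pmf_labelled_dist[of W lam "(e 0, True)"] e_in_X[of 0] card_X by auto

lemma err_D:
  assumes "finite W" "W \<noteq> {}" "h \<in> thresholds X"
  shows "err (D W) h = lam * (card {w \<in> W. h (fst w) \<noteq> snd w} / card W)"
proof -
  have "h (e 0)" using thresholdsE[OF assms(3)] card_X by (metis zero_le less_le_trans pos2)
  moreover have "W \<inter> {(x, y). h x \<noteq> y} = {w \<in> W. h (fst w) \<noteq> snd w}" by auto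
  ultimately show ?thesis
    unfolding err_def D_def using alpha assms(1,2) by (subst prob_labelled_dist) simp_all
qed

text \<open>The last assumption says that a sample from \<open>D W\<close> contains at most
  \<open>1 / 2\<close> points of \<open>W - W'\<close> in expectation. So some sample avoids all
  differences and is good for both distributions, and both simulators are close to the learner's
  output on it.\<close>

lemma sim_private:
  assumes W: "finite W" "W \<noteq> {}" "W \<subseteq> X \<times> UNIV" and W': "finite W'" "W' \<noteq> {}" "W' \<subseteq> X \<times> UNIV"
    and a: "(e 0, True) \<notin> W" "(e 0, True) \<notin> W'"
    and card: "card W = card W'" "2 * n * lam * card (W - W') \<le> card W"
  shows "measure_pmf.prob (sim (D W)) Q \<le> exp (1/4) * measure_pmf.prob (sim (D W')) Q + (1 + exp (1/8)) * \<delta>"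
proof -
  define E where "E = - ((W - W') \<union> (W' - W))"
  have "pmf (D W) z = pmf (D W') z" if "z \<in> E" for z
    unfolding D_def using alpha W W' card that
    by (intro pmf_labelled_dist_cong) (auto simp: E_def)
  moreover have "n * measure_pmf.prob (D W) (- E) \<le> 1 / 2"
  proof -
    have "W \<inter> - E = W - W'" by (auto simp: E_def)
    then have "measure_pmf.prob (D W) (- E) = lam * (card (W - W') / card W)"
      unfolding D_def using alpha W a by (subst prob_labelled_dist) (simp_all add: E_def)
    moreover have "card W > 0" using W by (simp add: card_gt_0_iff)
    ultimately have "n * measure_pmf.prob (D W) (- E) = (2 * n * lam * card (W - W')) / (2 * card W)"
      by simp
    also have "\<dots> \<le> card W / (2 * card W)"
      using card(2) by (intro divide_right_mono) simp_all
    finally show ?thesis using \<open>card W > 0\<close> by simp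
  qed
  ultimately obtain T where T: "close_dist (thresholds X) (1/8) \<delta> (M T) (sim (D W))"
      "close_dist (thresholds X) (1/8) \<delta> (M T) (sim (D W'))"
    using exists_common_good_sample[OF _ _ sim(2) sim(2) beta, of E "D W" "D W'"]
      D_in_dist_on[OF W] D_in_dist_on[OF W'] by auto
  from simulators_close[OF this sim(1) sim(1), OF D_in_dist_on[OF W] D_in_dist_on[OF W']]
  show ?thesis by simp
qed

text \<open>Since \<open>f\<close> has error \<open>0\<close>, an error of
  \<open>lam / 2 > \<alpha>\<close> violates the accuracy guarantee of the learner, which happens
  with probability at most \<open>1/32\<close>.\<close>

lemma sim_accurate:
  assumes W: "finite W" "W \<noteq> {}" "W \<subseteq> X \<times> UNIV"
    and f: "f \<in> thresholds X" "\<And>x l. (x, l) \<in> W \<Longrightarrow> f x = l"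
  shows "measure_pmf.prob (sim (D W)) {h \<in> thresholds X. lam / 2 \<le> err (D W) h} \<le> 2 / 25"
proof -
  let ?B = "{h \<in> thresholds X. lam / 2 \<le> err (D W) h}"
  let ?P = "replicate_pmf n (D W)"
  let ?A = "{h. err (D W) h \<le> (MIN f\<in>thresholds X. err (D W) f) + \<alpha>}"
  have none: "{w \<in> W. f (fst w) \<noteq> snd w} = {}" using f(2) by auto
  have "err (D W) f = 0"
    unfolding err_D[OF W(1,2) f(1)] none by simp
  moreover have "(MIN f\<in>thresholds X. err (D W) f) \<le> err (D W) f"
    using finite_X f(1) by (intro Min_le) (auto simp: thresholds_def)
  ultimately have "?B \<subseteq> - ?A"
    using alpha by auto
  then have "measure_pmf.prob (?P \<bind> M) ?B \<le> measure_pmf.prob (?P \<bind> M) (- ?A)"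
    by (rule measure_pmf.finite_measure_mono) simp
  also have "\<dots> = 1 - measure_pmf.prob (?P \<bind> M) ?A"
    using measure_pmf.prob_compl[of ?A "?P \<bind> M"] by (simp add: Compl_eq_Diff_UNIV)
  also have "\<dots> \<le> 1 / 32"
    using learner D_in_dist_on[OF W]
    unfolding proper_agnostic_learner_def accurate_agnostic_learner_def by force
  \<comment> \<open>With \<open>exp (1/8) \<le> 5/4\<close> this is at most
    \<open>5/64 + 1/10000 \<le> 2/25\<close>.\<close>
  finally have "measure_pmf.prob (sim (D W)) ?B \<le> 2 * exp (1/8) * (1/32) + \<delta>"
    using sim(2)[OF D_in_dist_on[OF W]] beta delta
    by (intro simulator_prob_le[where P = ?P and R = "thresholds X" and M = M]) auto
  also have "exp (1/8 :: real) \<le> 5 / 4"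
    by (rule exp_small_le)
  finally show ?thesis using delta by simp
qed

text \<open>Otherwise the learner would typically not see the label of \<open>e 1\<close> at all.\<close>

lemma lam_n_large: "lam * n > 1 / 2"
proof (rule ccontr)
  assume small: "\<not> ?thesis"
  let ?W = "\<lambda>l. {(e 1, l)}"
  let ?B = "\<lambda>l. {h \<in> thresholds X. lam / 2 \<le> err (D (?W l)) h}"
  have e01: "e 0 \<noteq> e 1" using e_eq[of 0 1] card_X by simp
  have W: "finite (?W l)" "?W l \<noteq> {}" "?W l \<subseteq> X \<times> UNIV" for l
    using e_in_X[of 1] card_X by auto
  have err: "err (D (?W l)) h = (if h (e 1) = l then 0 else lam)" if "h \<in> thresholds X" for h l
  proof -
    have *: "{w \<in> ?W l. h (fst w) \<noteq> snd w} = (if h (e 1) = l then {} else ?W l)" by auto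
    have "card {w \<in> ?W l. h (fst w) \<noteq> snd w} = (if h (e 1) = l then 0 else 1)"
      unfolding * by simp
    then show ?thesis unfolding err_D[OF W(1,2) that] by (simp only:) simp
  qed
  have thr: "threshold (e i) \<in> thresholds X" if "i < card X" for i
    using that e_in_X by (auto simp: thresholds_def)
  have sim_B: "measure_pmf.prob (sim (D (?W l))) (?B l) \<le> 2 / 25" for l
    by (rule sim_accurate[OF W, where f = "threshold (e (if l then 1 else 0))"])
       (use card_X e_le[of 1 0] e_le[of 1 1] thr in \<open>auto simp: threshold_def split: if_splits\<close>)
  have B_eq: "?B l = {h. h (e 1) \<noteq> l} \<inter> thresholds X" for l
  proof (intro set_eqI)
    fix h
    show "h \<in> ?B l \<longleftrightarrow> h \<in> {h. h (e 1) \<noteq> l} \<inter> thresholds X"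
      using err[of h l] alpha by (cases "h \<in> thresholds X"; cases "h (e 1) = l") simp_all
  qed
  have acc: "measure_pmf.prob (sim (D (?W l))) {h. h (e 1) \<noteq> l} \<le> 2 / 25" for l
    using sim_B[of l] unfolding B_eq prob_dist_on_Int[OF sim(1)[OF D_in_dist_on[OF W]]] .
  let ?p = "measure_pmf.prob (sim (D (?W True)))" and ?p' = "measure_pmf.prob (sim (D (?W False)))"
  \<comment> \<open>Each simulator must get its own label of \<open>e 1\<close> right with
    probability at least \<open>23/25\<close>. Yet the two sets are singletons, so
    \<open>sim_private\<close> asks only for \<open>2 * n * lam \<le> 1\<close> and makes the
    simulators close.\<close>
  have "1 - ?p {h. h (e 1) \<noteq> True} = ?p {h. h (e 1) \<noteq> False}"
    using measure_pmf.prob_neg[of "sim (D (?W True))" "\<lambda>h. h (e 1)"] by simp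
  also have "\<dots> \<le> exp (1/4) * ?p' {h. h (e 1) \<noteq> False} + (1 + exp (1/8)) * \<delta>"
    using small e01 by (intro sim_private W) (auto simp: mult.commute[of _ lam])
  also have "\<dots> \<le> (3/2) * (2/25) + (1 + 5/4) * (1/10000)"
    using acc[of False] delta exp_small_le by (intro add_mono mult_mono) simp_all
  finally show False
    using acc[of True] by simp
qed

text \<open>The lower half gets \<open>True\<close>: this labelling is realized by a threshold,
  while both constant labellings are wrong on exactly half of the points.\<close>

definition labelled_points :: "nat \<Rightarrow> nat set \<Rightarrow> ('a \<times> bool) set" where
  "labelled_points k P = (\<lambda>y. (e y, rank_in P y < k)) ` P"

lemma labelled_points:
  assumes P: "finite P" "P \<subseteq> {0<..<card X}" "card P = 2 * k" "k > 0"
  shows "finite (labelled_points k P)" "labelled_points k P \<noteq> {}" "labelled_points k P \<subseteq> X \<times> UNIV"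
    and "(e 0, True) \<notin> labelled_points k P"
    and "card (labelled_points k P) = 2 * k"
    and "inj_on (\<lambda>y. (e y, rank_in P y < k)) P"
proof -
  show "finite (labelled_points k P)" using P by (simp add: labelled_points_def)
  show "labelled_points k P \<noteq> {}" using P by (auto simp: labelled_points_def)
  show "labelled_points k P \<subseteq> X \<times> UNIV" using P e_in_X by (auto simp: labelled_points_def)
  show "(e 0, True) \<notin> labelled_points k P"
  proof
    assume "(e 0, True) \<in> labelled_points k P"
    then obtain y where "y \<in> P" "e 0 = e y" by (auto simp: labelled_points_def)
    then show False using P(2) e_eq[of 0 y] card_X by auto
  qed
  show inj: "inj_on (\<lambda>y. (e y, rank_in P y < k)) P"
  proof (rule inj_onI)
    fix y y' assume y: "y \<in> P" "y' \<in> P" "(e y, rank_in P y < k) = (e y', rank_in P y' < k)"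
    then have "y < card X" "y' < card X" using P(2) by auto
    with y(3) show "y = y'" by (simp add: e_eq)
  qed
  show "card (labelled_points k P) = 2 * k"
    unfolding labelled_points_def using P by (simp add: card_image[OF inj])
qed

text \<open>Exchanging one point shifts ranks by at most one, so a label changes only next to the median.\<close>

lemma card_labelled_points_diff:
  assumes "finite P" "finite P'" "P \<subseteq> insert u P'" "P' \<subseteq> insert u' P"
  shows "card (labelled_points k P - labelled_points k P') \<le> 3"
proof -
  \<comment> \<open>Ranks \<open>k - 1\<close> and \<open>k\<close> contribute at most two points,
    the exchanged point \<open>u\<close> a third.\<close>
  let ?N = "{y \<in> P. rank_in P y \<in> {k - 1, k}}"
  have "labelled_points k P - labelled_points k P' \<subseteq> (\<lambda>y. (e y, rank_in P y < k)) ` (insert u ?N)"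
  proof
    fix w assume w: "w \<in> labelled_points k P - labelled_points k P'"
    then obtain y where y: "y \<in> P" "w = (e y, rank_in P y < k)" by (auto simp: labelled_points_def)
    have "y \<in> insert u ?N"
    proof (cases "y \<in> P'")
      case True
      then have "(rank_in P y < k) \<noteq> (rank_in P' y < k)"
        using w y by (auto simp: labelled_points_def)
      moreover have "rank_in P y \<le> Suc (rank_in P' y)" "rank_in P' y \<le> Suc (rank_in P y)"
        using assms by (auto intro: rank_in_insert_le)
      ultimately show ?thesis using y by auto
    next
      case False
      then show ?thesis using y assms(3) by auto
    qed
    then show "w \<in> (\<lambda>y. (e y, rank_in P y < k)) ` (insert u ?N)" using y by blast
  qed
  then have "card (labelled_points k P - labelled_points k P') \<le> card ((\<lambda>y. (e y, rank_in P y < k)) ` (insert u ?N))"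
    using assms(1) by (intro card_mono) auto
  also have "\<dots> \<le> card (insert u ?N)"
    using assms(1) by (intro card_image_le) auto
  also have "\<dots> \<le> Suc (card ?N)"
    using assms(1) by (simp add: card_insert_if)
  also have "card ?N \<le> card {k - 1, k}"
    unfolding card_rank_in[OF assms(1)] by (intro card_mono) auto
  also have "\<dots> \<le> 2"
    by (simp add: card_insert_if)
  finally show ?thesis by simp
qed

text \<open>The threshold at the point of rank \<open>k - 1\<close> realizes the labels. A threshold
  constant on \<open>P\<close> errs on \<open>k\<close> of the \<open>2 * k\<close> points, which is
  error \<open>lam / 2\<close>.\<close>

lemma labelled_points_accurate:
  assumes P: "finite P" "P \<subseteq> {0<..<card X}" "card P = 2 * k" "k > 0"
  shows "measure_pmf.prob (sim (D (labelled_points k P)))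
    {h. (\<forall>y\<in>P. \<not> h (e y)) \<or> (\<forall>y\<in>P. h (e y))} \<le> 2 / 25"
proof -
  let ?W = "labelled_points k P"
  let ?Q = "{h. (\<forall>y\<in>P. \<not> h (e y)) \<or> (\<forall>y\<in>P. h (e y))}"
  note W = labelled_points[OF P]
  have "k - 1 \<in> rank_in P ` P"
    using bij_betw_rank_in[OF P(1)] P(3,4) by (auto simp: bij_betw_def)
  then obtain t where t: "t \<in> P" "rank_in P t = k - 1" by auto
  have lab: "y \<le> t \<longleftrightarrow> rank_in P y < k" if "y \<in> P" for y
    using rank_in_mono[OF P(1), of y t] rank_in_less[OF P(1) t(1), of y] t(2) P(4)
    by (cases "y \<le> t") auto
  have acc: "measure_pmf.prob (sim (D ?W)) {h \<in> thresholds X. lam / 2 \<le> err (D ?W) h} \<le> 2 / 25"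
  proof (rule sim_accurate[OF W(1-3)])
    show "threshold (e t) \<in> thresholds X"
      using t P(2) e_in_X by (auto simp: thresholds_def)
    show "threshold (e t) x = l" if "(x, l) \<in> ?W" for x l
    proof -
      from that obtain y where y: "y \<in> P" "x = e y" "l = (rank_in P y < k)"
        unfolding labelled_points_def by blast
      then have "y < card X" "t < card X" using t(1) P(2) by auto
      then show ?thesis using lab[OF y(1)] y by (simp add: threshold_def e_le)
    qed
  qed
  have half: "card {y \<in> P. rank_in P y < k} = k" "card {y \<in> P. \<not> rank_in P y < k} = k"
  proof -
    have "{..<card P} \<inter> {..<k} = {..<k}" "{..<card P} \<inter> {k..} = {k..<2 * k}" using P(3) by auto
    then show "card {y \<in> P. rank_in P y < k} = k" "card {y \<in> P. \<not> rank_in P y < k} = k"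
      using card_rank_in[OF P(1), of "{..<k}"] card_rank_in[OF P(1), of "{k..}"] by (simp_all add: not_less)
  qed
  have "lam / 2 \<le> err (D ?W) h" if h: "h \<in> thresholds X" "h \<in> ?Q" for h
  proof -
    have "{w \<in> ?W. h (fst w) \<noteq> snd w} = (\<lambda>y. (e y, rank_in P y < k)) ` {y \<in> P. h (e y) \<noteq> (rank_in P y < k)}"
      by (auto simp: labelled_points_def)
    then have "card {w \<in> ?W. h (fst w) \<noteq> snd w} = card {y \<in> P. h (e y) \<noteq> (rank_in P y < k)}"
      by (simp add: card_image inj_on_subset[OF W(6)])
    also have "\<dots> = k"
    proof -
      have "{y \<in> P. h (e y) \<noteq> (rank_in P y < k)} = {y \<in> P. rank_in P y < k} \<or>
            {y \<in> P. h (e y) \<noteq> (rank_in P y < k)} = {y \<in> P. \<not> rank_in P y < k}"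
        using h(2) by auto
      then show ?thesis using half by (elim disjE) simp_all
    qed
    finally show ?thesis
      using W P(4) by (simp add: err_D[OF W(1,2) h(1)])
  qed
  then have "?Q \<inter> thresholds X \<subseteq> {h \<in> thresholds X. lam / 2 \<le> err (D ?W) h}" by auto
  then have "measure_pmf.prob (sim (D ?W)) (?Q \<inter> thresholds X)
      \<le> measure_pmf.prob (sim (D ?W)) {h \<in> thresholds X. lam / 2 \<le> err (D ?W) h}"
    by (rule measure_pmf.finite_measure_mono) simp
  with acc show ?thesis
    using prob_dist_on_Int[OF sim(1)[OF D_in_dist_on[OF W(1-3)]], of ?Q] by simp
qed

text \<open>Adding the index makes the points distinct, so that they can be labelled by rank even if
  \<open>xs\<close> has repetitions; dividing by \<open>m\<close> undoes the blow-up.\<close>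

definition points :: "nat \<Rightarrow> nat list \<Rightarrow> nat set" where
  "points m xs = (\<lambda>j. xs ! j * m + j + 1) ` {..<m}"

text \<open>The threshold at \<open>e t\<close> has \<open>t + 1\<close> elements below or at it.
  Subtracting \<open>2\<close> yields \<open>t - 1\<close>, which also undoes the offset
  \<open>1\<close> that keeps \<open>points\<close> away from \<open>e 0\<close>.\<close>

definition decode :: "nat \<Rightarrow> ('a \<Rightarrow> bool) \<Rightarrow> nat" where
  "decode m h = (card {i. i < card X \<and> h (e i)} - 2) div m"

definition ipp_solver :: "nat \<Rightarrow> nat list \<Rightarrow> nat pmf" where
  "ipp_solver k xs = map_pmf (decode (2 * k)) (sim (D (labelled_points k (points (2 * k) xs))))"

lemma points:
  assumes "length xs = m" "set xs \<subseteq> {..<S}" "S * m < card X"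
  shows "finite (points m xs)" "points m xs \<subseteq> {0<..<card X}" "card (points m xs) = m"
proof -
  show "finite (points m xs)" by (simp add: points_def)
  have "xs ! j * m + j + 1 < card X" if "j < m" for j
  proof -
    have "xs ! j < S" using assms(1,2) that by (metis lessThan_iff nth_mem subsetD)
    then have "Suc (xs ! j) * m \<le> S * m" by (intro mult_le_mono1) simp
    then show ?thesis using that assms(3) by simp
  qed
  then show "points m xs \<subseteq> {0<..<card X}" by (auto simp: points_def)
  have "inj_on (\<lambda>j. xs ! j * m + j + 1) {..<m}"
  proof (rule inj_onI)
    fix i j assume "i \<in> {..<m}" "j \<in> {..<m}" "xs ! i * m + i + 1 = xs ! j * m + j + 1"
    then have "(xs ! i * m + i) mod m = (xs ! j * m + j) mod m" "i < m" "j < m" by simp_all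
    then show "i = j" by simp
  qed
  then show "card (points m xs) = m" by (simp add: points_def card_image)
qed

lemma points_list_update: "points m xs \<subseteq> insert (xs ! i * m + i + 1) (points m (xs[i := v]))"
proof
  fix y assume "y \<in> points m xs"
  then obtain j where j: "j < m" "y = xs ! j * m + j + 1" by (auto simp: points_def)
  show "y \<in> insert (xs ! i * m + i + 1) (points m (xs[i := v]))"
  proof (cases "i = j")
    case False
    then have "y = xs[i := v] ! j * m + j + 1" using j by simp
    then show ?thesis using j(1) unfolding points_def by blast
  qed (use j in simp)
qed

text \<open>A threshold not constant on the points has its index \<open>t\<close> between two of
  them; division by \<open>m\<close> is monotone and sends each point, less the offset, to its data
  value.\<close>

lemma interior_point_decode:
  assumes xs: "length xs = m" "set xs \<subseteq> {..<S}" "S * m < card X" and h: "h \<in> thresholds X"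
    and not_const: "\<exists>y\<in>points m xs. h (e y)" "\<exists>y\<in>points m xs. \<not> h (e y)"
  shows "interior_point xs (decode m h)"
proof -
  obtain t where t: "t < card X" "\<And>i. i < card X \<Longrightarrow> h (e i) \<longleftrightarrow> i \<le> t"
    using thresholdsE[OF h] by blast
  have "{i. i < card X \<and> h (e i)} = {..t}" using t by auto
  then have dec: "decode m h = (t - 1) div m" by (simp add: decode_def)
  have lt: "xs ! j * m + j + 1 < card X" if "j < m" for j
    using points(2)[OF xs] that by (auto simp: points_def)
  obtain i where i: "i < m" "xs ! i * m + i + 1 \<le> t"
    using not_const(1) t(2) lt by (auto simp: points_def)
  obtain j where j: "j < m" "t < xs ! j * m + j + 1"
    using not_const(2) t(2) lt by (fastforce simp: points_def)
  have "xs ! i = (xs ! i * m + i) div m" using i(1) by simp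
  also have "\<dots> \<le> (t - 1) div m" using i(2) by (intro div_le_mono) simp
  finally have "xs ! i \<le> decode m h" by (simp add: dec)
  moreover have "(t - 1) div m \<le> (xs ! j * m + j) div m" using j(2) by (intro div_le_mono) simp
  then have "decode m h \<le> xs ! j" using j(1) by (simp add: dec)
  ultimately show ?thesis
    unfolding interior_point_def using i(1) j(1) xs(1) nth_mem by blast
qed

lemma solves_ipp_solver:
  assumes "k > 0" "S * (2 * k) < card X"
  shows "solves_ipp (2 / 25) (2 * k) S (ipp_solver k)"
  unfolding solves_ipp_def
proof (intro allI impI)
  fix xs :: "nat list"
  assume xs: "length xs = 2 * k" "set xs \<subseteq> {..<S}"
  note P = points[OF xs assms(2)]
  let ?p = "measure_pmf.prob (sim (D (labelled_points k (points (2 * k) xs))))"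
  let ?Q = "decode (2 * k) -` {z. \<not> interior_point xs z}"
  have S: "sim (D (labelled_points k (points (2 * k) xs))) \<in> dist_on (thresholds X)"
    by (intro sim(1) D_in_dist_on labelled_points P assms(1))
  have "measure_pmf.prob (ipp_solver k xs) {z. \<not> interior_point xs z} = ?p (?Q \<inter> thresholds X)"
    by (simp add: ipp_solver_def prob_dist_on_Int[OF S])
  also have "\<dots> \<le> ?p {h. (\<forall>y\<in>points (2 * k) xs. \<not> h (e y)) \<or> (\<forall>y\<in>points (2 * k) xs. h (e y))}"
    using interior_point_decode[OF xs assms(2)] by (intro measure_pmf.finite_measure_mono) auto
  also have "\<dots> \<le> 2 / 25"
    by (rule labelled_points_accurate[OF P assms(1)])
  finally show "measure_pmf.prob (ipp_solver k xs) {z. \<not> interior_point xs z} \<le> 2 / 25" .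
qed

text \<open>At most \<open>3\<close> of the \<open>2 * k\<close> labelled points change, so
  \<open>sim_private\<close> asks for \<open>2 * n * lam * 3 \<le> 2 * k\<close>.\<close>

lemma diff_private_ipp_solver:
  assumes "k > 0" "S * (2 * k) < card X" "3 * lam * n \<le> k"
  shows "diff_private (exp (1/4)) ((1 + exp (1/8)) * \<delta>) (2 * k) S (ipp_solver k)"
  unfolding diff_private_def
proof (intro allI impI)
  fix xs :: "nat list" and v i Q
  assume xs: "length xs = 2 * k" "set xs \<subseteq> {..<S}" and i: "i < 2 * k" "v < S"
  let ?xs = "xs[i := v]"
  have xs': "length ?xs = 2 * k" "set ?xs \<subseteq> {..<S}"
    using xs i set_update_subset_insert[of xs i v] by auto
  note P = points[OF xs assms(2)] and P' = points[OF xs' assms(2)]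
  note W = labelled_points[OF P assms(1)] and W' = labelled_points[OF P' assms(1)]
  let ?W = "labelled_points k (points (2 * k) xs)" and ?W' = "labelled_points k (points (2 * k) ?xs)"
  \<comment> \<open>The reverse exchange restores entry \<open>i\<close>.\<close>
  have "points (2 * k) ?xs \<subseteq> insert (?xs ! i * (2 * k) + i + 1) (points (2 * k) xs)"
    using points_list_update[of "2 * k" ?xs i "xs ! i"] by simp
  then have "card (?W - ?W') \<le> 3"
    by (rule card_labelled_points_diff[OF P(1) P'(1) points_list_update])
  then have "2 * n * lam * card (?W - ?W') \<le> 2 * n * lam * 3"
    using alpha by (intro mult_left_mono) simp_all
  also have "\<dots> \<le> card ?W"
    using assms(3) by (simp add: W(5))
  finally have "2 * n * lam * card (?W - ?W') \<le> card ?W" .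
  then show "measure_pmf.prob (ipp_solver k xs) Q
      \<le> exp (1/4) * measure_pmf.prob (ipp_solver k ?xs) Q + (1 + exp (1/8)) * \<delta>"
    unfolding ipp_solver_def measure_map_pmf
    by (intro sim_private W(1-4) W'(1-4)) (simp_all add: W(5) W'(5))
qed

lemma log_star_card_le: "log_star (real (card X)) \<le> 410 * lam * n"
proof -
  define k where "k = nat \<lceil>3 * lam * n\<rceil>"
  have big: "lam * n > 1 / 2" by (rule lam_n_large)
  have k: "3 * lam * n \<le> k" "k \<le> 3 * lam * n + 1"
    using big unfolding k_def by linarith+
  then have "k > 0" using big by simp
  \<comment> \<open>The rounding \<open>+ 1\<close> is at most \<open>2 * (lam * n)\<close> because
    \<open>lam * n > 1 / 2\<close>.\<close>
  have k5: "k \<le> 5 * (lam * n)" using k big by linarith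
  have "lam * n \<le> n" using alpha by (simp add: mult_left_le_one_le)
  \<comment> \<open>\<open>b = 40 * k\<close> keeps the total guessing loss
    \<open>j * (K / b)\<close> below \<open>3/40\<close>; the form \<open>2 * (20 * k)\<close> fits
    \<open>ipp_domain_size_le_tower\<close>. The data set has \<open>j + 1 = 2 * k\<close>
    points.\<close>
  define b j S where "b = 2 * (20 * k)" and "j = 2 * k - 1" and "S = ipp_domain_size b j"
  have m: "2 * k = Suc j" using \<open>k > 0\<close> by (simp add: j_def)
  have "card X \<le> S * (2 * k)"
  proof (rule ccontr)
    assume "\<not> card X \<le> S * (2 * k)"
    then have S: "S * (2 * k) < card X" by simp
    let ?K = "exp (1/4 :: real)" and ?d = "(1 + exp (1/8)) * \<delta>"
    have "1 \<le> (1 + ?K) * (2 / 25 + j * (?K / b + ?d)) + ?d"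
      using diff_private_ipp_solver[OF \<open>k > 0\<close> S k(1)] solves_ipp_solver[OF \<open>k > 0\<close> S] \<open>k > 0\<close>
      unfolding m S_def by (intro private_ipp_lower_bound) (simp_all add: b_def)
    also have "\<dots> \<le> (1 + 3/2) * (2 / 25 + (3/40 + 9/4000)) + 9/40000"
    proof -
      have "j * (?K / b) \<le> (2 * k) * ((3/2) / b)"
        using exp_small_le by (intro mult_mono divide_right_mono) (simp_all add: j_def)
      also have "\<dots> = 3 / 40" using \<open>k > 0\<close> by (simp add: b_def)
      finally have 1: "j * (?K / b) \<le> 3 / 40" .
      have d: "?d \<le> (9/4) * \<delta>" using exp_small_le delta by (intro mult_right_mono) simp_all
      have "j \<le> 10 * real n" using k5 \<open>lam * n \<le> n\<close> m by linarith
      then have "j * ?d \<le> (10 * real n) * ((9/4) * \<delta>)"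
        using delta by (intro mult_mono d) simp_all
      also have "\<dots> = (45/2) * (n * \<delta>)" by simp
      also have "\<dots> \<le> (45/2) * (1 / 10000)" using delta(3) by (intro mult_left_mono) simp_all
      also have "\<dots> = 9/4000" by simp
      finally have 2: "j * ?d \<le> 9/4000" .
      have 3: "?d \<le> 9/40000" using d delta by linarith
      have "j * (?K / b + ?d) \<le> 3/40 + 9/4000" using add_mono[OF 1 2] by (simp only: distrib_left)
      then show ?thesis
        using exp_small_le delta 3 by (intro add_mono mult_mono) (simp_all add: add_nonneg_nonneg)
    qed
    finally show False by simp
  qed
  also have "\<dots> \<le> b * S" by (simp add: b_def)
  also have "\<dots> \<le> tower (4 * (20 * k) + j)"
    unfolding S_def b_def using \<open>k > 0\<close> by (intro ipp_domain_size_le_tower) simp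
  finally have "log_star (real (card X)) \<le> 4 * (20 * k) + j"
    by (intro log_star_le) simp
  also have "\<dots> \<le> 82 * k" by (simp add: j_def)
  finally have "real (log_star (real (card X))) \<le> 82 * real k" by linarith
  also have "\<dots> \<le> 410 * (lam * n)" using k5 by simp
  finally show ?thesis by simp
qed

end

section \<open>From the weight \<open>lam\<close> to the accuracy parameter
  \<open>\<alpha>\<close>\<close>

theorem theorem4p8:
  shows "\<exists>c::real. c > 0 \<and>
    (\<forall>(X :: 'a::linorder set) (\<alpha>::real) (n::nat) (\<delta>::real) (\<beta>::real) M.
       finite X \<longrightarrow> 0 < \<alpha> \<longrightarrow> \<alpha> < 1/2 \<longrightarrow>
       \<delta> \<le> 1 / (10000 * real n ^ 2) \<longrightarrow> \<beta> \<le> 1 / (10000 * real n ^ 2) \<longrightarrow>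
       proper_agnostic_learner X n \<alpha> (1/32) M \<longrightarrow>
       perfectly_generalizing (X \<times> UNIV) n (thresholds X) \<beta> (1/8) \<delta> M \<longrightarrow>
       real n \<ge> c * real (log_star (real (card X))) / \<alpha>)"
proof (intro exI[of _ "1 / 1640"] conjI allI impI)
  show "(0::real) < 1 / 1640" by simp
  fix X :: "'a set" and \<alpha> :: real and n :: nat and \<delta> \<beta> :: real and M
  assume X: "finite X" and \<alpha>: "0 < \<alpha>" "\<alpha> < 1/2"
    and le: "\<delta> \<le> 1 / (10000 * real n ^ 2)" "\<beta> \<le> 1 / (10000 * real n ^ 2)"
    and learner: "proper_agnostic_learner X n \<alpha> (1/32) M"
    and pg: "perfectly_generalizing (X \<times> UNIV) n (thresholds X) \<beta> (1/8) \<delta> M"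
  have "real (log_star (real (card X))) \<le> 1640 * \<alpha> * n"
  proof (cases "card X \<ge> 2")
    case False
    then have "log_star (real (card X)) \<le> 0" by (intro log_star_le) simp
    then show ?thesis using \<alpha> by simp
  next
    case True
    \<comment> \<open>\<open>\<beta>\<close> and \<open>\<delta>\<close> are bounded only from
      above, so both are enlarged to the nonnegative \<open>\<eta>\<close>, which is
      \<open>0\<close> for \<open>n = 0\<close> since division by zero gives
      \<open>0\<close>.\<close>
    define \<eta> where "\<eta> = 1 / (10000 * real n ^ 2)"
    \<comment> \<open>Both \<open>1\<close> and \<open>4 * \<alpha>\<close> exceed
      \<open>2 * \<alpha>\<close>, as \<open>\<alpha> < 1/2\<close>. The bound
      \<open>lam \<le> 4 * \<alpha>\<close> turns the constant \<open>410\<close> into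
      \<open>1640\<close>.\<close>
    define lam where "lam = min 1 (4 * \<alpha>)"
    have \<eta>: "0 \<le> \<eta>" "\<eta> \<le> 1 / 10000" "n * \<eta> \<le> 1 / 10000"
    proof -
      show "0 \<le> \<eta>" by (simp add: \<eta>_def)
      have "n * \<eta> = 1 / (10000 * n)" by (simp add: \<eta>_def power2_eq_square)
      also have "\<dots> \<le> 1 / 10000" by (cases "n = 0") (simp_all add: divide_le_eq)
      finally show "n * \<eta> \<le> 1 / 10000" .
      show "\<eta> \<le> 1 / 10000"
      proof (cases "n = 0")
        case False
        then have "1 * \<eta> \<le> n * \<eta>" using \<open>0 \<le> \<eta>\<close> by (intro mult_right_mono) simp_all
        with \<open>n * \<eta> \<le> 1 / 10000\<close> show ?thesis by simp
      qed (simp add: \<eta>_def)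
    qed
    obtain e :: "nat \<Rightarrow> 'a" where e: "bij_betw e {..<card X} X"
      "\<And>i j. i < card X \<Longrightarrow> j < card X \<Longrightarrow> e i \<le> e j \<longleftrightarrow> i \<le> j"
      using finite_linorder_enumeration[OF X] by blast
    interpret generalizing_learner X n \<alpha> \<eta> \<eta> lam M e
    proof
      show "perfectly_generalizing (X \<times> UNIV) n (thresholds X) \<eta> (1/8) \<eta> M"
        using perfectly_generalizing_mono[OF pg] le by (simp add: \<eta>_def)
    qed (use e True \<alpha> \<eta> learner in \<open>auto simp: lam_def\<close>)
    have "410 * lam * n \<le> 1640 * \<alpha> * n" by (intro mult_right_mono) (simp_all add: lam_def)
    with log_star_card_le show ?thesis by linarith
  qed
  then show "real n \<ge> 1 / 1640 * real (log_star (real (card X))) / \<alpha>"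
    using \<alpha> by (simp add: field_simps)
qed

end
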